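(* For every integer $n\ge 3$, the path $P_n$ on $n$ vertices satisfies \[ \operatorname{st}_{\gamma_{st}}(P_n)=\begin{cases}1,& \text{if } n\equiv 0,1 \pmod 3,\\ 2,& \text{if } n\equiv 2 \pmod 3.\end{cases} \]
   Context: All graphs are finite, simple and undirected. For a graph $G=(V,E)$, a set $D\subseteq V$ is a strong dominating set if every vertex $v\in V\setminus D$ is adjacent to some $u\in D$ with $\deg(v)\le\deg(u)$ (degrees taken in $G$). The strong domination number $\gamma_{st}(G)$ is the minimum size of a strong dominating set. For $S\subseteq V$, $G-S$ is the graph obtained by deleting the vertices of $S$. The stability of the strong domination number is $\operatorname{st}_{\gamma_{st}}(G)=\min\{|S| : S\subseteq V,\ \gamma_{st}(G-S)\ne\gamma_{st}(G)\}$. *)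

theory Defs
  imports "Graph_Theory.Graph_Theory"
begin

text \<open>
  A finite simple undirected graph is represented as a digraph satisfying the locale
  \<^locale>\<open>graph\<close>: finite, loop-free, without parallel arcs, and symmetric, so that an
  undirected edge is a pair of opposite arcs. Hence \<^const>\<open>out_degree\<close> is the degree and
  \<^const>\<open>dominates\<close> is adjacency.
\<close>

definition strong_dominating_set :: "('a, 'b) pre_digraph \<Rightarrow> 'a set \<Rightarrow> bool" where
  "strong_dominating_set G D \<longleftrightarrow>
     D \<subseteq> verts G \<and>
     (\<forall>v \<in> verts G - D. \<exists>u \<in> D. u \<rightarrow>\<^bsub>G\<^esub> v \<and> out_degree G v \<le> out_degree G u)"

definition strong_domination_number :: "('a, 'b) pre_digraph \<Rightarrow> nat" where
  "strong_domination_number G = Min {card D | D. strong_dominating_set G D}"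

definition delete_vertices :: "('a, 'b) pre_digraph \<Rightarrow> 'a set \<Rightarrow> ('a, 'b) pre_digraph" where
  "delete_vertices G S = induce_subgraph G (verts G - S)"

text \<open>
  Deleting all vertices is allowed; the graph without vertices has strong domination number 0.
\<close>

definition strong_domination_stability :: "('a, 'b) pre_digraph \<Rightarrow> nat" where
  "strong_domination_stability G =
     Min {card S | S. S \<subseteq> verts G \<and>
       strong_domination_number (delete_vertices G S) \<noteq> strong_domination_number G}"

definition path_graph :: "nat \<Rightarrow> (nat, nat \<times> nat) pre_digraph" where
  "path_graph n = with_proj
     \<lparr> pverts = {..<n},
       parcs = {(i, j). i < n \<and> j < n \<and> (j = i + 1 \<or> i = j + 1)} \<rparr>"

lemma graph_path_graph: "graph (path_graph n)"
proof -
  let ?A = "{(i, j). i < n \<and> j < n \<and> (j = i + 1 \<or> i = j + 1)}"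
  have "finite ?A"
    by (rule finite_subset[of _ "{..<n} \<times> {..<n}"]) auto
  then have "pair_graph \<lparr> pverts = {..<n}, parcs = ?A \<rparr>"
    by unfold_locales (auto simp: symmetric_def sym_def)
  then show ?thesis
    unfolding path_graph_def by (rule pair_graph.pair_graphD_graph)
qed

lemma graph_delete_vertices:
  assumes "graph G"
  shows "graph (delete_vertices G S)"
proof -
  interpret graph G by fact
  have ind: "induced_subgraph (delete_vertices G S) G"
    unfolding delete_vertices_def by (rule induced_induce) simp
  interpret H: digraph "delete_vertices G S" by (rule digraphI_induced[OF ind])
  interpret H: sym_digraph "delete_vertices G S" by (rule induced_graph_imp_graph[OF ind])
  show ?thesis by unfold_locales
qed

text \<open>
  Both minima range over finite nonempty sets of numbers (the second one as soon as the
  graph has a vertex), so \<^const>\<open>Min\<close> is the actual minimum.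
\<close>

lemma strong_domination_number_well_defined:
  assumes "graph G"
  shows "finite {card D | D. strong_dominating_set G D}"
    and "{card D | D. strong_dominating_set G D} \<noteq> {}"
proof -
  interpret graph G by fact
  have "{card D | D. strong_dominating_set G D} \<subseteq> card ` Pow (verts G)"
    by (auto simp: strong_dominating_set_def)
  then show "finite {card D | D. strong_dominating_set G D}"
    by (rule finite_subset) (simp add: finite_verts)
  have "strong_dominating_set G (verts G)"
    by (simp add: strong_dominating_set_def)
  then show "{card D | D. strong_dominating_set G D} \<noteq> {}"
    by blast
qed

lemma strong_domination_stability_well_defined:
  assumes "graph G"
  defines "A \<equiv> {card S | S. S \<subseteq> verts G \<and>
    strong_domination_number (delete_vertices G S) \<noteq> strong_domination_number G}"
  shows "finite A" and "verts G \<noteq> {} \<Longrightarrow> A \<noteq> {}"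
proof -
  interpret graph G by fact
  have "A \<subseteq> card ` Pow (verts G)"
    by (auto simp: A_def)
  then show "finite A"
    by (rule finite_subset) (simp add: finite_verts)
  assume ne: "verts G \<noteq> {}"
  have "{card D | D. strong_dominating_set (delete_vertices G (verts G)) D} = {0}"
    by (auto simp: strong_dominating_set_def delete_vertices_def)
  then have null: "strong_domination_number (delete_vertices G (verts G)) = 0"
    by (simp add: strong_domination_number_def)
  have "strong_domination_number G \<in> {card D | D. strong_dominating_set G D}"
    unfolding strong_domination_number_def
    using strong_domination_number_well_defined[OF \<open>graph G\<close>] by (intro Min_in)
  then obtain D where D: "strong_dominating_set G D" "strong_domination_number G = card D"
    by blast
  have "D \<noteq> {}" "finite D"
    using D(1) ne finite_subset[OF _ finite_verts] by (auto simp: strong_dominating_set_def)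
  then have "strong_domination_number G \<noteq> 0"
    using D(2) by simp
  with null have "card (verts G) \<in> A"
    unfolding A_def by (intro CollectI exI[of _ "verts G"]) simp
  then show "A \<noteq> {}"
    by blast
qed

end

theory Submission
  imports Defs
begin

text \<open>
  Everything reduces to the path with one vertex \<open>j\<close> deleted, that is, to two paths with
  \<open>j\<close> and \<open>n - 1 - j\<close> vertices; an intact path arises by deleting the last vertex of a path
  that is longer by one. Each component with \<open>m\<close> vertices contributes \<open>\<lceil>m / 3\<rceil>\<close>: every third
  vertex, starting with the first one, gives vertices with disjoint closed neighbourhoods, hence
  a lower bound, while the middle vertices of consecutive triples form a strong dominating set,
  except that the first vertex is taken in an incomplete last triple.
  The rest is arithmetic modulo 3.
\<close>

lemma strong_domination_number_eqI:
  assumes "graph G" "strong_dominating_set G D" "card D \<le> k"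
    and "\<And>D. strong_dominating_set G D \<Longrightarrow> k \<le> card D"
  shows "strong_domination_number G = k"
  unfolding strong_domination_number_def
proof (rule Min_eqI)
  show "finite {card D |D. strong_dominating_set G D}"
    using assms(1) by (rule strong_domination_number_well_defined)
  show "k \<in> {card D |D. strong_dominating_set G D}"
    using assms(2-4) by (auto intro: le_antisym)
qed (use assms(4) in auto)

section \<open>Degrees and adjacency in a path with deleted vertices\<close>

text \<open>\<open>V\<close> stands for the set of surviving vertices, so for \<open>v\<close> in
  \<open>V\<close> the cardinality is the degree after deletion. Writing \<open>v = w + 1\<close>
  avoids truncated subtraction at 0.\<close>

definition path_nbrs :: "nat set \<Rightarrow> nat \<Rightarrow> nat set" where
  "path_nbrs V v = {w \<in> V. w = v + 1 \<or> v = w + 1}"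

lemma path_nbrs_subset: "path_nbrs V v \<subseteq> {v - 1, v + 1}"
  by (auto simp: path_nbrs_def)

lemma finite_path_nbrs: "finite (path_nbrs V v)"
  using path_nbrs_subset by (rule finite_subset) simp

lemma card_path_nbrs_le: "card (path_nbrs V v) \<le> 2"
proof -
  have "card (path_nbrs V v) \<le> card {v - 1, v + 1}"
    by (intro card_mono path_nbrs_subset) simp
  also have "\<dots> \<le> 2" by (simp add: card_insert_if)
  finally show ?thesis .
qed

lemma verts_delete_path:
  "verts (delete_vertices (path_graph n) S) = {..<n} - S"
  by (simp add: delete_vertices_def path_graph_def)

lemma arcs_delete_path:
  "arcs (delete_vertices (path_graph n) S) =
    {(i, j). i \<in> {..<n} - S \<and> j \<in> path_nbrs ({..<n} - S) i}"
  by (auto simp: delete_vertices_def path_graph_def path_nbrs_def)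

lemma dominates_delete_path:
  "i \<rightarrow>\<^bsub>delete_vertices (path_graph n) S\<^esub> j \<longleftrightarrow>
    i \<in> {..<n} - S \<and> j \<in> path_nbrs ({..<n} - S) i"
proof -
  have "i \<rightarrow>\<^bsub>delete_vertices (path_graph n) S\<^esub> j \<longleftrightarrow>
      (i, j) \<in> arcs (delete_vertices (path_graph n) S)"
    by (auto simp: arcs_ends_def arc_to_ends_def delete_vertices_def path_graph_def)
  then show ?thesis by (simp add: arcs_delete_path)
qed

lemma out_degree_delete_path:
  assumes "v \<in> {..<n} - S"
  shows "out_degree (delete_vertices (path_graph n) S) v = card (path_nbrs ({..<n} - S) v)"
proof -
  have "tail (delete_vertices (path_graph n) S) = fst"
    by (simp add: delete_vertices_def path_graph_def)
  then have "out_arcs (delete_vertices (path_graph n) S) v = Pair v ` path_nbrs ({..<n} - S) v"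
    using assms by (auto simp: out_arcs_def arcs_delete_path)
  then show ?thesis
    by (simp add: out_degree_def card_image inj_on_def)
qed

lemma strong_dominating_set_delete_path:
  "strong_dominating_set (delete_vertices (path_graph n) S) D \<longleftrightarrow>
    D \<subseteq> {..<n} - S \<and>
    (\<forall>v \<in> {..<n} - S - D. \<exists>u \<in> D. (v = u + 1 \<or> u = v + 1) \<and>
      card (path_nbrs ({..<n} - S) v) \<le> card (path_nbrs ({..<n} - S) u))"
proof (cases "D \<subseteq> {..<n} - S")
  case True
  have "(u \<rightarrow>\<^bsub>delete_vertices (path_graph n) S\<^esub> v \<and>
      out_degree (delete_vertices (path_graph n) S) v
        \<le> out_degree (delete_vertices (path_graph n) S) u) \<longleftrightarrow>
      (v = u + 1 \<or> u = v + 1) \<and>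
      card (path_nbrs ({..<n} - S) v) \<le> card (path_nbrs ({..<n} - S) u)"
    if "u \<in> D" "v \<in> {..<n} - S - D" for u v
  proof -
    have "u \<in> {..<n} - S" "v \<in> {..<n} - S" using that True by auto
    then show ?thesis
      by (simp add: dominates_delete_path out_degree_delete_path) (auto simp: path_nbrs_def)
  qed
  then show ?thesis
    unfolding strong_dominating_set_def verts_delete_path by (meson True)
qed (simp add: strong_dominating_set_def verts_delete_path)

section \<open>Strong domination inside one component\<close>

text \<open>In an incomplete last triple the first vertex is the safe choice: if there is a second
  one, it is the end of the component and may have smaller degree than the first.\<close>

definition path_dominators :: "nat \<Rightarrow> nat \<Rightarrow> nat set" where
  "path_dominators s m = (\<lambda>i. s + (if 3 * i + 2 < m then 3 * i + 1 else 3 * i)) ` {..<(m + 2) div 3}"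

lemma card_path_dominators_le: "card (path_dominators s m) \<le> (m + 2) div 3"
  unfolding path_dominators_def by (rule order.trans[OF card_image_le]) simp_all

lemma path_dominators_subset: "path_dominators s m \<subseteq> {s..<s + m}"
  by (auto simp: path_dominators_def)

lemma path_dominators_strong:
  assumes V: "{s..<s + m} \<subseteq> V" "s + m \<notin> V"
    and v: "v \<in> {s..<s + m}" "v \<notin> path_dominators s m"
  shows "\<exists>u \<in> path_dominators s m. (v = u + 1 \<or> u = v + 1) \<and>
    card (path_nbrs V v) \<le> card (path_nbrs V u)"
proof -
  define i where "i = (v - s) div 3"
  define u where "u = s + (if 3 * i + 2 < m then 3 * i + 1 else 3 * i)"
  have "i < (m + 2) div 3" using v(1) by (auto simp: i_def)
  then have u: "u \<in> path_dominators s m"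
    unfolding path_dominators_def u_def by blast
  then have uv: "u \<noteq> v" using v(2) by blast
  have vi: "v = s + 3 * i + (v - s) mod 3" "(v - s) mod 3 < 3"
    using v(1) by (auto simp: i_def)
  have adj: "v = u + 1 \<or> u = v + 1"
    using vi uv v(1) by (auto simp: u_def split: if_splits)
  have "card (path_nbrs V v) \<le> card (path_nbrs V u)"
  proof (cases "3 * i + 2 < m")
    \<comment> \<open>The middle vertex of a complete triple has degree 2, the largest degree
      possible.\<close>
    case True
    then have "{u - 1, u + 1} \<subseteq> path_nbrs V u"
      using V(1) by (auto simp: path_nbrs_def u_def)
    then have "card {u - 1, u + 1} \<le> card (path_nbrs V u)"
      by (intro card_mono finite_path_nbrs)
    then show ?thesis using card_path_nbrs_le[of V v] True by (simp add: u_def)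
  next
    case False
    \<comment> \<open>The triple is incomplete and \<open>v\<close> is not its first vertex, so the
      triple has two vertices and \<open>v\<close> ends the component. Hence \<open>v\<close> has
      degree at most 1, while \<open>u\<close> has \<open>v\<close> as a neighbour.\<close>
    then have v_eq: "v = u + 1" "s + m = v + 1"
      using adj v(1) vi uv by (auto simp: u_def)
    then have "path_nbrs V v \<subseteq> {u}"
      using V(2) by (auto simp: path_nbrs_def)
    then have "card (path_nbrs V v) \<le> card {u}"
      by (intro card_mono) auto
    also have "\<dots> = card {v}" by simp
    also have "\<dots> \<le> card (path_nbrs V u)"
      using v_eq V(1) v(1) by (intro card_mono finite_path_nbrs) (auto simp: path_nbrs_def)
    finally show ?thesis .
  qed
  with u adj show ?thesis by blast
qed

section \<open>The strong domination number after one deletion\<close>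

text \<open>Choosing for each \<open>t\<close> a related element of \<open>D\<close> is injective,
  since no element of \<open>D\<close> serves two members of \<open>T\<close>.\<close>

lemma card_le_card_of_disjoint_nbhds:
  assumes "finite D" "\<And>t. t \<in> T \<Longrightarrow> \<exists>u \<in> D. R t u"
    and "\<And>t t' u. t \<in> T \<Longrightarrow> t' \<in> T \<Longrightarrow> u \<in> D \<Longrightarrow> R t u \<Longrightarrow> R t' u \<Longrightarrow> t = t'"
  shows "card T \<le> card D"
proof -
  obtain f where f: "\<And>t. t \<in> T \<Longrightarrow> f t \<in> D \<and> R t (f t)"
    using assms(2) by metis
  have "inj_on f T" using f assms(3) by (metis inj_onI)
  then show ?thesis using f assms(1) by (metis card_inj_on_le image_subsetI)
qed

lemma strong_domination_number_delete_path:
  assumes "j < n"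
  shows "strong_domination_number (delete_vertices (path_graph n) {j}) =
    (j + 2) div 3 + (n - 1 - j + 2) div 3"
proof (rule strong_domination_number_eqI)
  define V where "V = {..<n} - {j}"
  define D where "D = path_dominators 0 j \<union> path_dominators (j + 1) (n - 1 - j)"
  \<comment> \<open>The form \<open>0 + j\<close> matches the pattern \<open>s + m\<close> of
    \<open>path_dominators_strong\<close>.\<close>
  have V: "V = {0..<0 + j} \<union> {j + 1..<j + 1 + (n - 1 - j)}"
    using assms by (auto simp: V_def)
  have notin: "0 + j \<notin> V" "j + 1 + (n - 1 - j) \<notin> V" using assms by (auto simp: V_def)
  show "graph (delete_vertices (path_graph n) {j})"
    by (intro graph_delete_vertices graph_path_graph)
  have "D \<subseteq> V"
    unfolding D_def V by (intro Un_mono path_dominators_subset)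
  moreover have "\<exists>u \<in> D. (v = u + 1 \<or> u = v + 1) \<and>
      card (path_nbrs V v) \<le> card (path_nbrs V u)" if v: "v \<in> V - D" for v
  proof -
    have "v \<in> {0..<0 + j} \<or> v \<in> {j + 1..<j + 1 + (n - 1 - j)}" using v V by blast
    then show ?thesis
    proof
      assume "v \<in> {0..<0 + j}"
      with path_dominators_strong[OF _ notin(1), of v] v show ?thesis
        unfolding D_def V by blast
    next
      assume "v \<in> {j + 1..<j + 1 + (n - 1 - j)}"
      with path_dominators_strong[OF _ notin(2), of v] v show ?thesis
        unfolding D_def V by blast
    qed
  qed
  ultimately show "strong_dominating_set (delete_vertices (path_graph n) {j}) D"
    unfolding strong_dominating_set_delete_path V_def[symmetric] by blast
  show "card D \<le> (j + 2) div 3 + (n - 1 - j + 2) div 3"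
    unfolding D_def
    by (rule order.trans[OF card_Un_le]) (intro add_mono card_path_dominators_le)
next
  fix D assume "strong_dominating_set (delete_vertices (path_graph n) {j}) D"
  then have D: "D \<subseteq> {..<n} - {j}"
    \<comment> \<open>The degree condition is dropped: the lower bound already holds for ordinary
      domination.\<close>
    and dom: "\<And>v. v \<in> {..<n} - {j} \<Longrightarrow> \<exists>u \<in> D. v = u \<or> v = u + 1 \<or> u = v + 1"
    unfolding strong_dominating_set_delete_path by blast+
  let ?A = "(\<lambda>i. 3 * i) ` {..<(j + 2) div 3}"
  let ?B = "(\<lambda>i. j + 1 + 3 * i) ` {..<(n - 1 - j + 2) div 3}"
  have A: "t < j \<and> 3 dvd t" if "t \<in> ?A" for t using that by auto
  have B: "j < t \<and> t < n \<and> 3 dvd t - (j + 1)" if "t \<in> ?B" for t using that by auto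
  have "card (?A \<union> ?B) \<le> card D"
  proof (rule card_le_card_of_disjoint_nbhds)
    show "finite D" using D finite_subset by blast
    show "\<exists>u \<in> D. t = u \<or> t = u + 1 \<or> u = t + 1" if "t \<in> ?A \<union> ?B" for t
      using that A B assms by (intro dom) fastforce
    fix t t' u
    assume t: "t \<in> ?A \<union> ?B" "t' \<in> ?A \<union> ?B" and "u \<in> D"
      and u: "t = u \<or> t = u + 1 \<or> u = t + 1" "t' = u \<or> t' = u + 1 \<or> u = t' + 1"
    have "u \<noteq> j" using \<open>u \<in> D\<close> D by blast
    have close: "t \<le> t' + 2" "t' \<le> t + 2" using u by linarith+
    have eq: "x = y" if "3 dvd x" "3 dvd y" "x \<le> y + 2" "y \<le> x + 2" for x y :: nat
      using that by presburger
    \<comment> \<open>A vertex equal or adjacent to both \<open>a < j\<close> and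
      \<open>b > j\<close> could only be \<open>j\<close>, which has been deleted.\<close>
    have sep: False if "a \<in> ?A" "b \<in> ?B" "a = u \<or> a = u + 1 \<or> u = a + 1"
        "b = u \<or> b = u + 1 \<or> u = b + 1" for a b
      using A[OF that(1)] B[OF that(2)] that(3,4) \<open>u \<noteq> j\<close> by linarith
    have "t \<in> ?A \<and> t' \<in> ?A \<or> t \<in> ?B \<and> t' \<in> ?B"
      using t sep[OF _ _ u] sep[OF _ _ u(2) u(1)] by blast
    then consider "t \<in> ?A" "t' \<in> ?A" | "t \<in> ?B" "t' \<in> ?B"
      by blast
    then show "t = t'"
    proof cases
      case 1
      then show ?thesis using A[OF 1(1)] A[OF 1(2)] eq close by blast
    next
      case 2
      then have "t - (j + 1) = t' - (j + 1)"
        using B[OF 2(1)] B[OF 2(2)] close by (intro eq) linarith+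
      then show ?thesis using B[OF 2(1)] B[OF 2(2)] by linarith
    qed
  qed
  moreover have "card (?A \<union> ?B) = card ?A + card ?B"
    by (intro card_Un_disjoint) (use A B in fastforce)+
  ultimately show "(j + 2) div 3 + (n - 1 - j + 2) div 3 \<le> card D"
    by (simp add: card_image inj_on_def)
qed

section \<open>Intact paths and stability\<close>

text \<open>Cutting off a final segment keeps the labels of the other vertices, so this is an
  equality and not merely an isomorphism.\<close>

lemma delete_vertices_path_tail:
  assumes "m \<le> n"
  shows "delete_vertices (path_graph n) {m..<n} = path_graph m"
  using assms
  by (auto simp: delete_vertices_def path_graph_def induce_subgraph_def with_proj_def)

lemma strong_domination_number_path:
  "strong_domination_number (path_graph m) = (m + 2) div 3"
proof -
  have "delete_vertices (path_graph (m + 1)) {m} = path_graph m"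
    using delete_vertices_path_tail[of m "m + 1"] by simp
  then show ?thesis
    using strong_domination_number_delete_path[of m "m + 1"] by simp
qed

lemma strong_domination_stability_eqI:
  assumes "graph G" "S \<subseteq> verts G"
    and "strong_domination_number (delete_vertices G S) \<noteq> strong_domination_number G"
    and "\<And>S'. S' \<subseteq> verts G \<Longrightarrow> card S' < card S \<Longrightarrow>
      strong_domination_number (delete_vertices G S') = strong_domination_number G"
  shows "strong_domination_stability G = card S"
  unfolding strong_domination_stability_def
proof (rule Min_eqI)
  show "finite {card S |S. S \<subseteq> verts G \<and>
      strong_domination_number (delete_vertices G S) \<noteq> strong_domination_number G}"
    using assms(1) by (rule strong_domination_stability_well_defined)
qed (use assms(2-4) in \<open>auto simp: not_less[symmetric]\<close>)

text \<open>The two component sizes add up to 1 modulo 3, so their residues are 0 and 1 in some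
  order or 2 and 2; in each case the rounded-up thirds add up to \<open>k + 1\<close>. Hence no
  single deletion changes the number when \<open>n\<close> is 2 modulo 3.\<close>

lemma div3_round_up_split:
  fixes j k n :: nat
  assumes n: "n = 3 * k + 2" and j: "j < n"
  shows "(j + 2) div 3 + (n - 1 - j + 2) div 3 = (n + 2) div 3"
proof -
  define l where "l = n - 1 - j"
  have jl: "j + l = 3 * k + 1" using n j by (simp add: l_def)
  then have "j mod 3 = 0 \<and> l mod 3 = 1 \<or> j mod 3 = 1 \<and> l mod 3 = 0 \<or> j mod 3 = 2 \<and> l mod 3 = 2"
    by presburger
  moreover have "j = 3 * (j div 3) + j mod 3" "l = 3 * (l div 3) + l mod 3" by simp_all
  ultimately obtain q p where
    "j = 3 * q \<and> l = 3 * p + 1 \<or> j = 3 * q + 1 \<and> l = 3 * p \<or> j = 3 * q + 2 \<and> l = 3 * p + 2"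
    by (metis add_0_right)
  then show ?thesis
    unfolding l_def[symmetric] using n jl by auto
qed

theorem proposition2p2:
  fixes n :: nat
  assumes "n \<ge> 3"
  shows "strong_domination_stability (path_graph n) =
    (if n mod 3 = 0 \<or> n mod 3 = 1 then 1 else 2)"
proof -
  have verts: "verts (path_graph n) = {..<n}" by (simp add: path_graph_def)
  have empty: "strong_domination_number (delete_vertices (path_graph n) S) =
      strong_domination_number (path_graph n)" if "S \<subseteq> {..<n}" "card S = 0" for S
  proof -
    have "S = {}" using that finite_subset[OF that(1)] by simp
    then show ?thesis using delete_vertices_path_tail[of n n] by simp
  qed
  \<comment> \<open>The premise on single deletions is vacuous for a one-element witness, so all
    three cases can use this fact.\<close>
  have stab: "strong_domination_stability (path_graph n) = card S"
    if "S \<subseteq> {..<n}"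
      "strong_domination_number (delete_vertices (path_graph n) S) \<noteq> (n + 2) div 3"
      "\<And>j. 1 < card S \<Longrightarrow> j < n \<Longrightarrow> (j + 2) div 3 + (n - 1 - j + 2) div 3 = (n + 2) div 3"
      "card S \<le> 2" for S
  proof (rule strong_domination_stability_eqI)
    fix S' assume S': "S' \<subseteq> verts (path_graph n)" "card S' < card S"
    then have "card S' = 0 \<or> card S' = 1 \<and> 1 < card S" using that(4) by linarith
    then show "strong_domination_number (delete_vertices (path_graph n) S') =
        strong_domination_number (path_graph n)"
    proof
      assume *: "card S' = 1 \<and> 1 < card S"
      then obtain j where "S' = {j}" by (metis card_1_singletonE)
      with * S' that(3)[of j] verts show ?thesis
        by (simp add: strong_domination_number_delete_path strong_domination_number_path)
    qed (use S' verts empty in simp)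
  qed (use that in \<open>auto simp: verts graph_path_graph strong_domination_number_path\<close>)
  have n: "n = 3 * (n div 3) + n mod 3" by simp
  consider "n mod 3 = 0" | "n mod 3 = 1" | "n mod 3 = 2" by linarith
  then show ?thesis
  proof cases
    case 1
    then obtain k where "n = 3 * k + 3" using n assms by (cases "n div 3") auto
    \<comment> \<open>Deleting vertex 1 isolates vertex 0 and leaves a path on
      \<open>3 * k + 1\<close> vertices: the number rises from \<open>k + 1\<close> to
      \<open>k + 2\<close>.\<close>
    then have "(1 + 2) div 3 + (n - 1 - 1 + 2) div 3 \<noteq> (n + 2) div 3" by simp
    with stab[of "{1}"] 1 assms show ?thesis
      by (simp add: strong_domination_number_delete_path)
  next
    case 2
    then obtain k where "n = 3 * k + 1" using n by metis
    \<comment> \<open>Deleting the last vertex lowers the number from \<open>k + 1\<close> to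
      \<open>k\<close>.\<close>
    then have "(n - 1 + 2) div 3 \<noteq> (n + 2) div 3" by simp
    with stab[of "{n - 1..<n}"] 2 assms show ?thesis
      by (simp add: subset_eq delete_vertices_path_tail strong_domination_number_path)
  next
    case 3
    then obtain k where k: "n = 3 * k + 2" using n by metis
    \<comment> \<open>Deleting the last two vertices leaves \<open>3 * k\<close> vertices, and the
      number falls from \<open>k + 1\<close> to \<open>k\<close>.\<close>
    then have "(n - 2 + 2) div 3 \<noteq> (n + 2) div 3" by simp
    moreover have "(j + 2) div 3 + (n - 1 - j + 2) div 3 = (n + 2) div 3" if "j < n" for j
      using k that by (rule div3_round_up_split)
    ultimately show ?thesis using stab[of "{n - 2..<n}"] 3 assms
      by (simp add: subset_eq delete_vertices_path_tail strong_domination_number_path)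
  qed
qed

end
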